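(* Let $N$ be a timelike ruled surface of type $N_-$ in $\mathbb{R}_1^3$ with timelike striction curve $\vec c$ and curvatures $k_1,k_2$, and let $N^\alpha$ be an $\alpha$-transversal surface of $N$ whose striction curve $\vec c_\alpha$ coincides with $\vec c$. Then $\vec c$ is a line of curvature on $N$ if and only if $$\alpha'=\frac{k_2^2-k_1^2}{k_1}$$ holds on $I$.
   Context: $\mathbb{R}_1^3$ is Minkowski 3-space with metric $\langle\cdot,\cdot\rangle=-dx_1^2+dx_2^2+dx_3^2$. A nonzero vector $\vec v$ is timelike if $\langle\vec v,\vec v\rangle<0$, null if $\langle\vec v,\vec v\rangle=0$, spacelike if $\langle\vec v,\vec v\rangle>0$. Setting. All functions are smooth on an open interval $I$. A timelike ruled surface of type $N_-$ with timelike striction curve is $\vec r(s,v)=\vec c(s)+v\vec q(s)$, with ruling direction $\vec q$ unit timelike, where $\vec c$ is its striction curve, a timelike curve parametrized by arc length $s$. It has a Frenet frame $\{\vec q,\vec h,\vec a\}$ of mutually orthogonal vectors, $\langle\vec q,\vec q\rangle=-1$, $\langle\vec h,\vec h\rangle=\langle\vec a,\vec a\rangle=1$ ($\vec h$ is the central normal, i.e. the surface normal along $\vec c$; $\vec a$ the central tangent), with $\vec q\,'=k_1\vec h$, $\vec h'=k_1\vec q+k_2\vec a$, $\vec a'=-k_2\vec h$ (prime is $d/ds$) for functions $k_1,k_2$. Standing assumption: the derivatives of the frame vectors are non-null and $N$ is non-cylindrical; in particular $k_1\neq0$ and $k_1^2\neq k_2^2$ everywhere. The unit tangent of $\vec c$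 is $\vec c\,'=\vec t=\cosh\theta\,\vec q+\sinh\theta\,\vec a$ for a real function $\theta$ (the hyperbolic angle between $\vec t$ and $\vec q$). $\alpha$-transversal surface. For a function $\alpha:I\to\mathbb{R}$, $N^\alpha$ is the ruled surface $\vec r_\alpha(s,v)=\vec c(s)+v\vec q_\alpha(s)$ with $\vec q_\alpha=\mu\vec q+\eta\vec h$, where either $(\mu,\eta)=(\cosh\alpha,\sinh\alpha)$ on all of $I$ ($\vec q_\alpha$ timelike) or $(\mu,\eta)=(\sinh\alpha,\cosh\alpha)$ on all of $I$ ($\vec q_\alpha$ spacelike); it is assumed that $\mu\ne0$ and $\eta\neq0$ everywhere and that $\langle\vec q_\alpha',\vec q_\alpha'\rangle\neq0$ everywhere. Its striction curve is $\vec c_\alpha=\vec c+v_\alpha\vec q_\alpha$ with $v_\alpha=-\langle\vec c\,',\vec q_\alpha'\rangle/\langle\vec q_\alpha',\vec q_\alpha'\rangle$; it coincides with $\vec c$ if $v_\alpha=0$ on $I$. The curve $\vec c$ is a line of curvature on $N$ if $\vec h'$ and $\vec t$ are linearly dependent on $I$, i.e. $\vec h'=\lambda\vec t$ for some scalar function $\lambda=\lambda(s)$. *)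

theory Defs
  imports "HOL-Analysis.Analysis"
begin

section \<open>Minkowski 3-space\<close>

text \<open>The underlying vector space is \<open>real^3\<close>; the Euclidean structure of that type is only used
  for differentiation, never for lengths or angles.\<close>

definition mink :: "real^3 \<Rightarrow> real^3 \<Rightarrow> real" where
  "mink v w = - (v$1 * w$1) + v$2 * w$2 + v$3 * w$3"

text \<open>The zero vector is not null.\<close>

definition null_vector :: "real^3 \<Rightarrow> bool" where
  "null_vector v \<longleftrightarrow> v \<noteq> 0 \<and> mink v v = 0"

lemma mink_add_left: "mink (u + v) w = mink u w + mink v w"
  and mink_add_right: "mink u (v + w) = mink u v + mink u w"
  and mink_scale_left: "mink (x *\<^sub>R u) w = x * mink u w"
  and mink_scale_right: "mink u (x *\<^sub>R w) = x * mink u w"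
  and mink_zero_right: "mink u 0 = 0"
  and mink_commute: "mink u w = mink w u"
  by (simp_all add: mink_def algebra_simps)


section \<open>Curves and ruled surfaces\<close>

text \<open>Smooth means infinitely differentiable; \<open>I\<close> is meant to be open, so that all
  iterated derivatives depend only on the values of \<open>f\<close> on \<open>I\<close>.\<close>

definition smooth_on :: "real set \<Rightarrow> (real \<Rightarrow> 'a::real_normed_vector) \<Rightarrow> bool" where
  "smooth_on I f \<longleftrightarrow>
     (\<forall>n. \<forall>s\<in>I. ((\<lambda>g t. vector_derivative g (at t)) ^^ n) f differentiable (at s))"

text \<open>A ruled surface \<open>r(s,v) = c(s) + v d(s)\<close> is represented by its base curve \<open>c\<close> and its
  ruling direction \<open>d\<close>. On each ruling the striction point has the parameter
  \<open>v = - \<langle>c', d'\<rangle> / \<langle>d', d'\<rangle>\<close>.\<close>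

definition striction_param ::
    "(real \<Rightarrow> real^3) \<Rightarrow> (real \<Rightarrow> real^3) \<Rightarrow> real \<Rightarrow> real" where
  "striction_param c d s =
     - mink (vector_derivative c (at s)) (vector_derivative d (at s))
       / mink (vector_derivative d (at s)) (vector_derivative d (at s))"

definition striction_curve ::
    "(real \<Rightarrow> real^3) \<Rightarrow> (real \<Rightarrow> real^3) \<Rightarrow> real \<Rightarrow> real^3" where
  "striction_curve c d s = c s + striction_param c d s *\<^sub>R d s"

lemma striction_curve_eq_base_iff:
  "d s \<noteq> 0 \<Longrightarrow> striction_curve c d s = c s \<longleftrightarrow> striction_param c d s = 0"
  by (simp add: striction_curve_def)

text \<open>\<open>h\<close> is the unit normal of the surface along \<open>c\<close>.\<close>

definition line_of_curvature ::
    "real set \<Rightarrow> (real \<Rightarrow> real^3) \<Rightarrow> (real \<Rightarrow> real^3) \<Rightarrow> bool" where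
  "line_of_curvature I h c \<longleftrightarrow>
     (\<exists>lam :: real \<Rightarrow> real. \<forall>s\<in>I.
        vector_derivative h (at s) = lam s *\<^sub>R vector_derivative c (at s))"


section \<open>Timelike ruled surfaces of type \<open>N\<^sub>-\<close> with timelike striction curve\<close>

text \<open>The surface \<open>c(s) + v q(s)\<close> is timelike at each of its regular points because its tangent
  plane there contains the timelike vector \<open>q\<close>, so this needs no assumption of its own.
  Some assumptions are redundant: \<open>c'\<close> being unit timelike and \<open>c\<close> being the striction curve
  follow from the formula for \<open>c'\<close> and the frame equations.\<close>

locale timelike_ruled_surface =
  fixes I :: "real set"
    and c :: "real \<Rightarrow> real^3"
    and q h a :: "real \<Rightarrow> real^3"
    and k\<^sub>1 k\<^sub>2 :: "real \<Rightarrow> real"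
    and \<theta> :: "real \<Rightarrow> real"
  assumes interval: "open I" "is_interval I" "I \<noteq> {}"
    and smooth: "smooth_on I c" "smooth_on I q" "smooth_on I h" "smooth_on I a"
      "smooth_on I k\<^sub>1" "smooth_on I k\<^sub>2" "smooth_on I \<theta>"
    and frame_norms: "\<And>s. s \<in> I \<Longrightarrow> mink (q s) (q s) = -1"
      "\<And>s. s \<in> I \<Longrightarrow> mink (h s) (h s) = 1"
      "\<And>s. s \<in> I \<Longrightarrow> mink (a s) (a s) = 1"
    and frame_orth: "\<And>s. s \<in> I \<Longrightarrow> mink (q s) (h s) = 0"
      "\<And>s. s \<in> I \<Longrightarrow> mink (q s) (a s) = 0"
      "\<And>s. s \<in> I \<Longrightarrow> mink (h s) (a s) = 0"
    and frenet: "\<And>s. s \<in> I \<Longrightarrow> (q has_vector_derivative k\<^sub>1 s *\<^sub>R h s) (at s)"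
      "\<And>s. s \<in> I \<Longrightarrow> (h has_vector_derivative k\<^sub>1 s *\<^sub>R q s + k\<^sub>2 s *\<^sub>R a s) (at s)"
      "\<And>s. s \<in> I \<Longrightarrow> (a has_vector_derivative - k\<^sub>2 s *\<^sub>R h s) (at s)"
    and non_null: "\<And>s. s \<in> I \<Longrightarrow> \<not> null_vector (vector_derivative q (at s))"
      "\<And>s. s \<in> I \<Longrightarrow> \<not> null_vector (vector_derivative h (at s))"
      "\<And>s. s \<in> I \<Longrightarrow> \<not> null_vector (vector_derivative a (at s))"
    and non_cylindrical: "\<And>s. s \<in> I \<Longrightarrow> vector_derivative q (at s) \<noteq> 0"
    and arc_length: "\<And>s. s \<in> I \<Longrightarrow> mink (vector_derivative c (at s)) (vector_derivative c (at s)) = -1"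
    and tangent: "\<And>s. s \<in> I \<Longrightarrow>
      vector_derivative c (at s) = cosh (\<theta> s) *\<^sub>R q s + sinh (\<theta> s) *\<^sub>R a s"
    and striction: "\<And>s. s \<in> I \<Longrightarrow> striction_curve c q s = c s"
begin

lemma k1_nonzero: "s \<in> I \<Longrightarrow> k\<^sub>1 s \<noteq> 0"
  using non_cylindrical[of s] vector_derivative_at[OF frenet(1), of s] by auto

lemma k1_squared_neq: assumes s: "s \<in> I" shows "(k\<^sub>1 s)\<^sup>2 \<noteq> (k\<^sub>2 s)\<^sup>2"
proof
  assume eq: "(k\<^sub>1 s)\<^sup>2 = (k\<^sub>2 s)\<^sup>2"
  let ?w = "k\<^sub>1 s *\<^sub>R q s + k\<^sub>2 s *\<^sub>R a s"
  have orth: "mink (q s) (a s) = 0" "mink (a s) (q s) = 0"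
    using frame_orth(2)[OF s] mink_commute by auto
  have "mink ?w ?w = 0"
    using eq by (simp add: mink_add_left mink_add_right mink_scale_left mink_scale_right
        frame_norms[OF s] orth power2_eq_square)
  moreover have "mink (q s) ?w = - k\<^sub>1 s"
    by (simp add: mink_add_right mink_scale_right frame_norms[OF s] orth)
  then have "?w \<noteq> 0"
    using k1_nonzero[OF s] by (metis mink_zero_right neg_equal_0_iff_equal)
  ultimately show False
    using non_null(2)[OF s] vector_derivative_at[OF frenet(2)[OF s]]
    by (simp add: null_vector_def)
qed

text \<open>The two tangent vectors of the surface at \<open>v = 0\<close> are \<open>c'(s)\<close> and \<open>q(s)\<close>, so \<open>h\<close> is
  normal to the surface along \<open>c\<close>.\<close>

lemma central_normal:
  assumes s: "s \<in> I"
  shows "mink (h s) (vector_derivative c (at s)) = 0" "mink (h s) (q s) = 0"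
  using frame_orth[OF s] mink_commute[of "h s" "q s"]
  by (simp_all add: tangent[OF s] mink_add_right mink_scale_right)

end


section \<open>\<open>\<alpha>\<close>-transversal surfaces\<close>

locale alpha_transversal_surface = timelike_ruled_surface +
  fixes \<alpha> \<mu> \<eta> :: "real \<Rightarrow> real"
    and q\<^sub>\<alpha> :: "real \<Rightarrow> real^3"
  assumes smooth_alpha: "smooth_on I \<alpha>"
    and coefficients: "(\<forall>s\<in>I. \<mu> s = cosh (\<alpha> s) \<and> \<eta> s = sinh (\<alpha> s)) \<or>
      (\<forall>s\<in>I. \<mu> s = sinh (\<alpha> s) \<and> \<eta> s = cosh (\<alpha> s))"
    and ruling: "\<And>s. s \<in> I \<Longrightarrow> q\<^sub>\<alpha> s = \<mu> s *\<^sub>R q s + \<eta> s *\<^sub>R h s"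
    and coefficients_nonzero: "\<And>s. s \<in> I \<Longrightarrow> \<mu> s \<noteq> 0" "\<And>s. s \<in> I \<Longrightarrow> \<eta> s \<noteq> 0"
    and ruling_derivative:
      "\<And>s. s \<in> I \<Longrightarrow> mink (vector_derivative q\<^sub>\<alpha> (at s)) (vector_derivative q\<^sub>\<alpha> (at s)) \<noteq> 0"

end

(*
  Both choices of (\<mu>, \<eta>) satisfy \<mu>' = \<alpha>' \<eta> and \<eta>' = \<alpha>' \<mu>, so the Frenet equations give
  q\<^sub>\<alpha>' = (\<alpha>' + k\<^sub>1) (\<eta> q + \<mu> h) + \<eta> k\<^sub>2 a. Since \<eta> is nonzero, the striction curves coincide iff
  (\<alpha>' + k\<^sub>1) cosh \<theta> = k\<^sub>2 sinh \<theta>, whereas c is a line of curvature iff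
  k\<^sub>2 cosh \<theta> = k\<^sub>1 sinh \<theta>. Eliminating \<theta> between these equations yields the formula for \<alpha>'.
  For the converse one has to divide by k\<^sub>2: where k\<^sub>2 = 0, the first equation would force
  \<alpha>' + k\<^sub>1 = 0 and hence q\<^sub>\<alpha>' = 0, contrary to q\<^sub>\<alpha>' being non-null.
*)
theory Submission
  imports Defs
begin

context timelike_ruled_surface
begin

lemma mink_frame:
  assumes "s \<in> I"
  shows "mink (x1 *\<^sub>R q s + y1 *\<^sub>R h s + z1 *\<^sub>R a s) (x2 *\<^sub>R q s + y2 *\<^sub>R h s + z2 *\<^sub>R a s) =
    - (x1 * x2) + y1 * y2 + z1 * z2"
  using frame_norms[OF assms] frame_orth[OF assms]
    mink_commute[of "h s" "q s"] mink_commute[of "a s" "q s"] mink_commute[of "a s" "h s"]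
  by (simp add: mink_add_left mink_add_right mink_scale_left mink_scale_right)

text \<open>Pairing with \<open>q s\<close> and \<open>a s\<close> recovers the two coefficients,
  the first up to sign because \<open>q s\<close> is timelike.\<close>

lemma frame_eq_iff:
  assumes s: "s \<in> I"
  shows "x1 *\<^sub>R q s + z1 *\<^sub>R a s = x2 *\<^sub>R q s + z2 *\<^sub>R a s \<longleftrightarrow> x1 = x2 \<and> z1 = z2"
proof -
  have "mink (x *\<^sub>R q s + z *\<^sub>R a s) (q s) = - x" "mink (x *\<^sub>R q s + z *\<^sub>R a s) (a s) = z" for x z
    using mink_frame[OF s, of x 0 z 1 0 0] mink_frame[OF s, of x 0 z 0 0 1] by simp_all
  then show ?thesis
    by (metis neg_equal_iff_equal)
qed

text \<open>Both \<open>h'\<close> and \<open>c'\<close> lie in the span of \<open>q\<close> and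
  \<open>a\<close>, so proportionality amounts to two scalar equations, from which the multiplier
  can be eliminated pointwise.\<close>

lemma line_of_curvature_iff:
  "line_of_curvature I h c \<longleftrightarrow> (\<forall>s\<in>I. k\<^sub>2 s * cosh (\<theta> s) = k\<^sub>1 s * sinh (\<theta> s))"
proof -
  have "vector_derivative h (at s) = l *\<^sub>R vector_derivative c (at s) \<longleftrightarrow>
      k\<^sub>1 s = l * cosh (\<theta> s) \<and> k\<^sub>2 s = l * sinh (\<theta> s)" if "s \<in> I" for s l
    using frame_eq_iff[OF that, of "k\<^sub>1 s" "k\<^sub>2 s" "l * cosh (\<theta> s)" "l * sinh (\<theta> s)"]
    by (simp add: vector_derivative_at[OF frenet(2)[OF that]] tangent[OF that] scaleR_add_right)
  moreover have "(\<exists>l. k = l * cosh t \<and> k' = l * sinh t) \<longleftrightarrow> k' * cosh t = k * sinh t"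
    for k k' t :: real
  proof
    assume "k' * cosh t = k * sinh t"
    \<comment> \<open>Since \<open>cosh t\<close> never vanishes, the first equation dictates this
      multiplier.\<close>
    then have "k = (k / cosh t) * cosh t \<and> k' = (k / cosh t) * sinh t"
      by (simp add: eq_divide_eq)
    then show "\<exists>l. k = l * cosh t \<and> k' = l * sinh t"
      by blast
  qed auto
  ultimately show ?thesis
    \<comment> \<open>Choice gathers the pointwise multipliers into one function; no regularity is
      asked of it.\<close>
    using bchoice_iff[of I "\<lambda>s l. k\<^sub>1 s = l * cosh (\<theta> s) \<and> k\<^sub>2 s = l * sinh (\<theta> s)"]
    by (simp add: line_of_curvature_def)
qed

end

context alpha_transversal_surface
begin

lemma alpha_has_derivative:
  assumes "s \<in> I"
  shows "(\<alpha> has_real_derivative deriv \<alpha> s) (at s)"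
proof -
  \<comment> \<open>The zeroth iterate is \<alpha> itself.\<close>
  have "((\<lambda>g t. vector_derivative g (at t)) ^^ 0) \<alpha> differentiable (at s)"
    using smooth_alpha assms unfolding smooth_on_def by blast
  then show ?thesis
    by (simp add: DERIV_deriv_iff_real_differentiable)
qed

text \<open>\<open>cosh\<close> and \<open>sinh\<close> are each other's derivative without a sign
  change, so the timelike and the spacelike ruling obey the same formulas and need no separate
  treatment afterwards.\<close>

lemma coefficients_has_derivative:
  assumes s: "s \<in> I"
  shows "(\<mu> has_real_derivative deriv \<alpha> s * \<eta> s) (at s)"
    and "(\<eta> has_real_derivative deriv \<alpha> s * \<mu> s) (at s)"
proof -
  have C: "((\<lambda>s. cosh (\<alpha> s)) has_real_derivative deriv \<alpha> s * sinh (\<alpha> s)) (at s)"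
    and S: "((\<lambda>s. sinh (\<alpha> s)) has_real_derivative deriv \<alpha> s * cosh (\<alpha> s)) (at s)"
    by (auto intro!: derivative_eq_intros alpha_has_derivative[OF s])
  have "(\<mu> has_real_derivative deriv \<alpha> s * \<eta> s) (at s) \<and>
    (\<eta> has_real_derivative deriv \<alpha> s * \<mu> s) (at s)"
    using coefficients
  proof
    assume "\<forall>s\<in>I. \<mu> s = cosh (\<alpha> s) \<and> \<eta> s = sinh (\<alpha> s)"
    then show ?thesis
      using has_field_derivative_transform_within_open[OF C interval(1) s, of \<mu>]
        has_field_derivative_transform_within_open[OF S interval(1) s, of \<eta>] s by simp
  next
    assume "\<forall>s\<in>I. \<mu> s = sinh (\<alpha> s) \<and> \<eta> s = cosh (\<alpha> s)"
    then show ?thesis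
      using has_field_derivative_transform_within_open[OF S interval(1) s, of \<mu>]
        has_field_derivative_transform_within_open[OF C interval(1) s, of \<eta>] s by simp
  qed
  then show "(\<mu> has_real_derivative deriv \<alpha> s * \<eta> s) (at s)"
    and "(\<eta> has_real_derivative deriv \<alpha> s * \<mu> s) (at s)"
    by simp_all
qed

lemma vector_derivative_ruling:
  assumes s: "s \<in> I"
  shows "vector_derivative q\<^sub>\<alpha> (at s) =
    ((deriv \<alpha> s + k\<^sub>1 s) * \<eta> s) *\<^sub>R q s + ((deriv \<alpha> s + k\<^sub>1 s) * \<mu> s) *\<^sub>R h s + (\<eta> s * k\<^sub>2 s) *\<^sub>R a s"
proof -
  have "((\<lambda>s. \<mu> s *\<^sub>R q s + \<eta> s *\<^sub>R h s) has_vector_derivative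
      (\<mu> s *\<^sub>R (k\<^sub>1 s *\<^sub>R h s) + (deriv \<alpha> s * \<eta> s) *\<^sub>R q s) +
      (\<eta> s *\<^sub>R (k\<^sub>1 s *\<^sub>R q s + k\<^sub>2 s *\<^sub>R a s) + (deriv \<alpha> s * \<mu> s) *\<^sub>R h s)) (at s)"
    by (intro has_vector_derivative_add has_vector_derivative_scaleR
        coefficients_has_derivative[OF s] frenet[OF s])
  then have "(q\<^sub>\<alpha> has_vector_derivative
      (\<mu> s *\<^sub>R (k\<^sub>1 s *\<^sub>R h s) + (deriv \<alpha> s * \<eta> s) *\<^sub>R q s) +
      (\<eta> s *\<^sub>R (k\<^sub>1 s *\<^sub>R q s + k\<^sub>2 s *\<^sub>R a s) + (deriv \<alpha> s * \<mu> s) *\<^sub>R h s)) (at s)"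
    \<comment> \<open>\<open>ruling\<close> describes \<open>q\<^sub>\<alpha>\<close> on
      \<open>I\<close> only; openness of \<open>I\<close> makes this enough for the
      derivative.\<close>
    by (rule has_vector_derivative_transform_within_open[OF _ interval(1) s])
      (simp add: ruling)
  then show ?thesis
    by (simp add: vector_derivative_at algebra_simps)
qed

lemma ruling_nonzero:
  assumes s: "s \<in> I"
  shows "q\<^sub>\<alpha> s \<noteq> 0"
proof
  assume "q\<^sub>\<alpha> s = 0"
  then have "mink (\<mu> s *\<^sub>R q s + \<eta> s *\<^sub>R h s) (q s) = 0"
    by (simp add: ruling[OF s] mink_def)
  then show False
    using mink_frame[OF s, of "\<mu> s" "\<eta> s" 0 1 0 0] coefficients_nonzero(1)[OF s] by simp
qed

text \<open>As \<open>c'\<close> has no \<open>h\<close> component, only the \<open>q\<close> and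
  \<open>a\<close> components of the ruling's derivative enter the numerator of the striction
  parameter, and both carry the nonzero factor \<eta>.\<close>

lemma striction_coincides_iff:
  assumes s: "s \<in> I"
  shows "striction_curve c q\<^sub>\<alpha> s = c s \<longleftrightarrow>
    (deriv \<alpha> s + k\<^sub>1 s) * cosh (\<theta> s) = k\<^sub>2 s * sinh (\<theta> s)"
proof -
  have "mink (vector_derivative c (at s)) (vector_derivative q\<^sub>\<alpha> (at s)) =
    \<eta> s * (k\<^sub>2 s * sinh (\<theta> s) - (deriv \<alpha> s + k\<^sub>1 s) * cosh (\<theta> s))"
    using mink_frame[OF s, of "cosh (\<theta> s)" 0 "sinh (\<theta> s)" "(deriv \<alpha> s + k\<^sub>1 s) * \<eta> s"
        "(deriv \<alpha> s + k\<^sub>1 s) * \<mu> s" "\<eta> s * k\<^sub>2 s"]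
    by (simp add: tangent[OF s] vector_derivative_ruling[OF s] algebra_simps)
  then show ?thesis
    using ruling_derivative[OF s] coefficients_nonzero(2)[OF s]
    by (auto simp: striction_curve_eq_base_iff[of q\<^sub>\<alpha>, OF ruling_nonzero[OF s]]
        striction_param_def)
qed

lemma k2_nonzero_if_striction_coincides:
  assumes s: "s \<in> I" and "striction_curve c q\<^sub>\<alpha> s = c s"
  shows "k\<^sub>2 s \<noteq> 0"
proof
  assume k2: "k\<^sub>2 s = 0"
  then have "deriv \<alpha> s + k\<^sub>1 s = 0"
    using assms striction_coincides_iff[OF s] by simp
  then have "vector_derivative q\<^sub>\<alpha> (at s) = 0"
    using k2 by (simp add: vector_derivative_ruling[OF s])
  then show False
    using ruling_derivative[OF s] by (simp add: mink_zero_right)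
qed

lemma line_of_curvature_condition_iff:
  assumes s: "s \<in> I" and coincide: "striction_curve c q\<^sub>\<alpha> s = c s"
  shows "k\<^sub>2 s * cosh (\<theta> s) = k\<^sub>1 s * sinh (\<theta> s) \<longleftrightarrow>
    deriv \<alpha> s = ((k\<^sub>2 s)\<^sup>2 - (k\<^sub>1 s)\<^sup>2) / k\<^sub>1 s"
proof -
  have st: "(deriv \<alpha> s + k\<^sub>1 s) * cosh (\<theta> s) = k\<^sub>2 s * sinh (\<theta> s)"
    using coincide striction_coincides_iff[OF s] by simp
  have "deriv \<alpha> s = ((k\<^sub>2 s)\<^sup>2 - (k\<^sub>1 s)\<^sup>2) / k\<^sub>1 s \<longleftrightarrow> k\<^sub>1 s * (deriv \<alpha> s + k\<^sub>1 s) = (k\<^sub>2 s)\<^sup>2"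
    using k1_nonzero[OF s] by (auto simp: eq_divide_eq algebra_simps power2_eq_square)
  \<comment> \<open>Multiplying by the positive number \<open>cosh (\<theta> s)\<close> is
    reversible and produces the left side of \<open>st\<close>.\<close>
  also have "\<dots> \<longleftrightarrow> k\<^sub>1 s * ((deriv \<alpha> s + k\<^sub>1 s) * cosh (\<theta> s)) = (k\<^sub>2 s)\<^sup>2 * cosh (\<theta> s)"
    by (simp flip: mult.assoc)
  also have "\<dots> \<longleftrightarrow> k\<^sub>2 s * (k\<^sub>1 s * sinh (\<theta> s)) = k\<^sub>2 s * (k\<^sub>2 s * cosh (\<theta> s))"
    unfolding st by (simp add: power2_eq_square mult_ac)
  also have "\<dots> \<longleftrightarrow> k\<^sub>2 s * cosh (\<theta> s) = k\<^sub>1 s * sinh (\<theta> s)"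
    using k2_nonzero_if_striction_coincides[OF assms] by auto
  finally show ?thesis ..
qed

end

theorem theorem4p4:
  fixes I :: "real set"
    and c q h a q\<^sub>\<alpha> :: "real \<Rightarrow> real^3"
    and k\<^sub>1 k\<^sub>2 \<theta> \<alpha> \<mu> \<eta> :: "real \<Rightarrow> real"
  assumes "alpha_transversal_surface I c q h a k\<^sub>1 k\<^sub>2 \<theta> \<alpha> \<mu> \<eta> q\<^sub>\<alpha>"
    and "\<forall>s\<in>I. striction_curve c q\<^sub>\<alpha> s = c s"
  shows "line_of_curvature I h c \<longleftrightarrow>
    (\<forall>s\<in>I. deriv \<alpha> s = ((k\<^sub>2 s)\<^sup>2 - (k\<^sub>1 s)\<^sup>2) / k\<^sub>1 s)"
proof -
  interpret alpha_transversal_surface I c q h a k\<^sub>1 k\<^sub>2 \<theta> \<alpha> \<mu> \<eta> q\<^sub>\<alpha>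
    by (fact assms(1))
  show ?thesis
    using assms(2) by (simp add: line_of_curvature_iff line_of_curvature_condition_iff)
qed

end
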